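(* Consider $K$ hash tables, each with $2^t$ buckets addressed by $\{0,1\}^t$. Applying the Aggregate-Counts procedure to each table computes, for every table and every address $i$, the values $C_i[r]$ for $r=0,1,\dots,t$. Each $C_i[r]$ equals the total number of elements stored in that table in buckets at Hamming distance exactly $r$ from $i$. The total running time is $O(Kt^22^t)$ arithmetic operations.
   Context: For a single table, let $b_i$ be the number of elements in bucket $i\in\{0,1\}^t$, and let $\mathcal{N}_i$ be the set of the $t$ addresses at Hamming distance $1$ from $i$. Aggregate-Counts runs rounds $r=0,1,\dots,t$. In each round, for every address $i$ it sets: - $C_i[0]=b_i$ if $r=0$; - $C_i[1]=\sum_{j\in\mathcal{N}_i}C_j[0]$ if $r=1$; - $C_i[r]=\dfrac{\sum_{j\in\mathcal{N}_i}C_j[r-1]-(t-r+2)\,C_i[r-2]}{r}$ if $r\ge2$. It then returns all $C_i$. *)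

theory Defs
  imports Complex_Main "HOL-Library.Multiset" "HOL-Library.Monad_Syntax"
begin

section \<open>Addresses and Hamming distance\<close>

type_synonym address = "bool list"

definition addresses :: "nat \<Rightarrow> address set" where
  "addresses t = {i. length i = t}"

definition hamming :: "address \<Rightarrow> address \<Rightarrow> nat" where
  "hamming i j = card {p. p < length i \<and> i ! p \<noteq> j ! p}"

definition neighbours :: "nat \<Rightarrow> address \<Rightarrow> address set" where
  "neighbours t i = {j \<in> addresses t. hamming i j = 1}"

text \<open>The program below visits the neighbours of an address by flipping one bit at a time;
  \<open>neighbours_flip\<close> shows that this enumerates \<^const>\<open>neighbours\<close>
  without repetition.\<close>

definition flip_at :: "nat \<Rightarrow> address \<Rightarrow> address" where
  "flip_at p i = i[p := \<not> i ! p]"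

lemma neighbours_flip:
  assumes "i \<in> addresses t"
  shows "bij_betw (\<lambda>p. flip_at p i) {..<t} (neighbours t i)"
  unfolding bij_betw_def
proof
  have len: "length i = t" using assms by (simp add: addresses_def)
  show "inj_on (\<lambda>p. flip_at p i) {..<t}"
  proof (rule inj_onI)
    fix p q assume p: "p \<in> {..<t}" and eq: "flip_at p i = flip_at q i"
    from p have "flip_at p i ! p = (\<not> i ! p)" by (simp add: flip_at_def len)
    moreover have "flip_at q i ! p = i ! p" if "p \<noteq> q"
      using that by (simp add: flip_at_def)
    ultimately show "p = q" unfolding eq by blast
  qed
  show "(\<lambda>p. flip_at p i) ` {..<t} = neighbours t i"
  proof (intro equalityI subsetI)
    fix j assume "j \<in> (\<lambda>p. flip_at p i) ` {..<t}"
    then obtain p where p: "p < t" and j: "j = flip_at p i" by auto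
    have "{q. q < length i \<and> i ! q \<noteq> j ! q} = {p}"
      using p by (auto simp: j flip_at_def len nth_list_update)
    then show "j \<in> neighbours t i"
      by (simp add: neighbours_def addresses_def hamming_def j flip_at_def len)
  next
    fix j assume "j \<in> neighbours t i"
    then have lj: "length j = t" and "card {q. q < length i \<and> i ! q \<noteq> j ! q} = 1"
      by (auto simp: neighbours_def addresses_def hamming_def)
    then obtain p where P: "{q. q < length i \<and> i ! q \<noteq> j ! q} = {p}"
      by (meson card_1_singletonE)
    have "p \<in> {q. q < length i \<and> i ! q \<noteq> j ! q}" unfolding P by simp
    then have p: "p < t" by (simp add: len)
    have "j = flip_at p i"
    proof (rule nth_equalityI)
      show "length j = length (flip_at p i)" by (simp add: lj len flip_at_def)
      fix q assume "q < length j"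
      then have "q \<in> {q. q < length i \<and> i ! q \<noteq> j ! q} \<longleftrightarrow> i ! q \<noteq> j ! q"
        by (simp add: lj len)
      then have "i ! q \<noteq> j ! q \<longleftrightarrow> q = p" unfolding P by simp
      moreover have "flip_at p i ! q = (if q = p then \<not> i ! q else i ! q)"
        using p by (simp add: flip_at_def len)
      ultimately show "j ! q = flip_at p i ! q" by metis
    qed
    with p show "j \<in> (\<lambda>p. flip_at p i) ` {..<t}" by auto
  qed
qed

section \<open>Computations that record the operations they perform\<close>

text \<open>Unit-cost model: a computation is its result together with the list of the elementary
  operations executed. \<open>Arith\<close> is one addition, subtraction, multiplication or
  division; \<open>Addr\<close> is flipping one bit of an address (one machine word);
  \<open>Control\<close> is one loop iteration or one case distinction.\<close>

datatype operation = Arith | Addr | Load | Store | Control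

type_synonym 'a run = "'a \<times> operation list"

definition result :: "'a run \<Rightarrow> 'a" where
  "result m = fst m"

definition arith_ops :: "'a run \<Rightarrow> nat" where
  "arith_ops m = count_list (snd m) Arith"

definition total_ops :: "'a run \<Rightarrow> nat" where
  "total_ops m = length (snd m)"

definition ret :: "'a \<Rightarrow> 'a run" where
  "ret x = (x, [])"

definition bind_run :: "'a run \<Rightarrow> ('a \<Rightarrow> 'b run) \<Rightarrow> 'b run" where
  "bind_run m f = (fst (f (fst m)), snd m @ snd (f (fst m)))"

adhoc_overloading Monad_Syntax.bind \<rightleftharpoons> bind_run

definition control :: "unit run" where
  "control = ((), [Control])"

definition add :: "'a::plus \<Rightarrow> 'a \<Rightarrow> 'a run" where
  "add x y = (x + y, [Arith])"

definition sub :: "'a::minus \<Rightarrow> 'a \<Rightarrow> 'a run" where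
  "sub x y = (x - y, [Arith])"

definition mul :: "'a::times \<Rightarrow> 'a \<Rightarrow> 'a run" where
  "mul x y = (x * y, [Arith])"

definition quot :: "rat \<Rightarrow> rat \<Rightarrow> rat run" where
  "quot x y = (x / y, [Arith])"

definition flip :: "nat \<Rightarrow> address \<Rightarrow> address run" where
  "flip p i = (flip_at p i, [Addr])"

definition load :: "('l \<Rightarrow> 'v) \<Rightarrow> 'l \<Rightarrow> 'v run" where
  "load C l = (C l, [Load])"

definition store :: "'l \<Rightarrow> 'v \<Rightarrow> ('l \<Rightarrow> 'v) \<Rightarrow> ('l \<Rightarrow> 'v) run" where
  "store l v C = (C(l := v), [Store])"

fun for_each :: "'x list \<Rightarrow> ('x \<Rightarrow> 's \<Rightarrow> 's run) \<Rightarrow> 's \<Rightarrow> 's run" where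
  "for_each [] f s = ret s"
| "for_each (x # xs) f s = do { control; s' \<leftarrow> f x s; for_each xs f s' }"

section \<open>Aggregate-Counts\<close>

text \<open>Cell \<open>(k, i, r)\<close> of the memory holds \<open>C\<^sub>i[r]\<close> of table \<open>k\<close>. The input
  \<open>b k i\<close> is the number of elements in bucket \<open>i\<close> of table \<open>k\<close>. Division is exact,
  so the cells hold rational numbers.\<close>

type_synonym memory = "nat \<times> address \<times> nat \<Rightarrow> rat"

type_synonym bucket_counts = "nat \<Rightarrow> address \<Rightarrow> nat"

definition neighbour_sum :: "nat \<Rightarrow> nat \<Rightarrow> address \<Rightarrow> nat \<Rightarrow> memory \<Rightarrow> rat run" where
  "neighbour_sum t k i r C =
     for_each [0..<t]
       (\<lambda>p s. do { j \<leftarrow> flip p i; x \<leftarrow> load C (k, j, r); add s x }) 0"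

definition entry :: "nat \<Rightarrow> bucket_counts \<Rightarrow> nat \<Rightarrow> nat \<Rightarrow> address \<Rightarrow> memory \<Rightarrow> rat run" where
  "entry t b k r i C = do {
     control;
     if r = 0 then load (\<lambda>i. of_nat (b k i)) i
     else if r = 1 then neighbour_sum t k i 0 C
     else do {
       r1 \<leftarrow> sub r 1;
       s \<leftarrow> neighbour_sum t k i r1 C;
       r2 \<leftarrow> sub r 2;
       y \<leftarrow> load C (k, i, r2);
       d \<leftarrow> sub (of_nat t) (of_nat r);
       c \<leftarrow> add d 2;
       m \<leftarrow> mul c y;
       n \<leftarrow> sub s m;
       quot n (of_nat r)
     }
   }"

definition aggregate_counts :: "nat \<Rightarrow> bucket_counts \<Rightarrow> nat \<Rightarrow> memory \<Rightarrow> memory run" where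
  "aggregate_counts t b k =
     for_each [0..<Suc t] (\<lambda>r.
       for_each (List.n_lists t [False, True]) (\<lambda>i C. do {
         v \<leftarrow> entry t b k r i C;
         store (k, i, r) v C
       }))"

definition aggregate_all :: "nat \<Rightarrow> nat \<Rightarrow> bucket_counts \<Rightarrow> memory \<Rightarrow> memory run" where
  "aggregate_all K t b = for_each [0..<K] (aggregate_counts t b)"

end

theory Submission
  imports Defs
begin

text \<open>Let \<open>W\<^sub>r(i)\<close> be the number of elements at distance exactly \<open>r\<close> from \<open>i\<close>.
  If \<open>d\<close> is the distance from \<open>i\<close> to \<open>m\<close>, then \<open>d\<close> of the \<open>t\<close> neighbours of \<open>i\<close> are
  at distance \<open>d - 1\<close> from \<open>m\<close> and the other \<open>t - d\<close> at distance \<open>d + 1\<close>. Double counting therefore gives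
  \<open>(\<Sum>j\<in>N\<^sub>i. W\<^sub>s(j)) = (s + 1) W\<^sub>s\<^sub>+\<^sub>1(i) + (t - s + 1) W\<^sub>s\<^sub>-\<^sub>1(i)\<close>, and the recurrence
  of the algorithm is this identity solved for \<open>W\<^sub>s\<^sub>+\<^sub>1\<close>.\<close>

section \<open>The distance-counting recurrence\<close>

text \<open>This is W of the overview, with a weight \<open>f\<close> in place of bucket sizes. It
  stays in \<open>nat\<close>, so the counting identity involves no division; rationals enter only
  when it is compared with memory cells.\<close>

definition shell_sum :: "nat \<Rightarrow> (address \<Rightarrow> nat) \<Rightarrow> nat \<Rightarrow> address \<Rightarrow> nat" where
  "shell_sum t f r i = (\<Sum>j | j \<in> addresses t \<and> hamming i j = r. f j)"

lemma addresses_eq_n_lists: "addresses t = set (List.n_lists t [False, True])"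
proof -
  have "set xs \<subseteq> {False, True}" for xs :: address
    by auto
  then show ?thesis
    by (simp add: addresses_def set_n_lists)
qed

lemma length_n_lists_Bool: "length (List.n_lists t [False, True]) = 2 ^ t"
  by (simp add: length_n_lists numeral_2_eq_2)

lemma finite_addresses: "finite (addresses t)"
  by (simp add: addresses_eq_n_lists)

lemma flip_at_in_addresses: "i \<in> addresses t \<Longrightarrow> flip_at p i \<in> addresses t"
  by (simp add: addresses_def flip_at_def)

text \<open>Flipping bit \<open>p\<close> removes \<open>p\<close> from the set of differing
  positions or inserts it. In the first case that set contains \<open>p\<close>, so the truncated
  subtraction is exact.\<close>

lemma hamming_flip_at:
  assumes "p < length i"
  shows "hamming (flip_at p i) m = (if i ! p \<noteq> m ! p then hamming i m - 1 else Suc (hamming i m))"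
proof -
  let ?D = "{q. q < length i \<and> i ! q \<noteq> m ! q}"
  have "{q. q < length (flip_at p i) \<and> flip_at p i ! q \<noteq> m ! q}
      = (if i ! p \<noteq> m ! p then ?D - {p} else insert p ?D)"
    using assms by (auto simp: flip_at_def nth_list_update)
  then show ?thesis
    using assms by (simp add: hamming_def)
qed

lemma hamming_eq_0_iff:
  assumes "i \<in> addresses t" "j \<in> addresses t"
  shows "hamming i j = 0 \<longleftrightarrow> i = j"
  using assms by (auto simp: hamming_def addresses_def intro: nth_equalityI)

text \<open>Each of the d = \<open>hamming i m\<close> differing positions gives a flip at distance
  d - 1, each of the t - d agreeing ones a flip at distance d + 1.\<close>

lemma card_flips_at_distance:
  assumes i: "i \<in> addresses t"
  shows "card {p. p < t \<and> hamming (flip_at p i) m = s}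
    = (if hamming i m = Suc s then Suc s else 0)
      + (if Suc (hamming i m) = s then t - hamming i m else 0)"
proof -
  have len: "length i = t"
    using i by (simp add: addresses_def)
  let ?D = "{p. p < t \<and> i ! p \<noteq> m ! p}"
  let ?E = "{p. p < t \<and> i ! p = m ! p}"
  have D: "card ?D = hamming i m"
    by (simp add: hamming_def len)
  have "?E = {..<t} - ?D"
    by auto
  then have E: "card ?E = t - hamming i m"
    using D by (simp add: card_Diff_subset subset_eq)
  have "hamming (flip_at p i) m = s \<longleftrightarrow>
      (if p \<in> ?D then hamming i m = Suc s else Suc (hamming i m) = s)" if "p < t" for p
  proof (cases "p \<in> ?D")
    case True
    then have "hamming i m \<noteq> 0"
      unfolding D[symmetric] by auto
    then show ?thesis
      using True that by (cases "hamming i m") (simp_all add: hamming_flip_at len)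
  next
    case False
    then show ?thesis
      using that by (simp add: hamming_flip_at len)
  qed
  then have split: "{p. p < t \<and> hamming (flip_at p i) m = s}
      = (if hamming i m = Suc s then ?D else {}) \<union> (if Suc (hamming i m) = s then ?E else {})"
    by (intro set_eqI) (simp, metis)
  \<comment> \<open>The two conditions exclude each other, so at most one part of the union is
    nonempty.\<close>
  show ?thesis
    unfolding split using D E by auto
qed

text \<open>Double counting: after exchanging the sums, \<open>f m\<close> is weighted by the number
  of flips of \<open>i\<close> at distance \<open>s\<close> from \<open>m\<close>. The case
  \<open>s = 0\<close> is separate because \<open>s - 1\<close> would truncate to 0 and add a
  spurious term.\<close>

lemma sum_shell_sum_flips:
  assumes i: "i \<in> addresses t"
  shows "(\<Sum>p<t. shell_sum t f s (flip_at p i))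
    = Suc s * shell_sum t f (Suc s) i
      + (if s = 0 then 0 else (t - (s - 1)) * shell_sum t f (s - 1) i)"
proof -
  let ?A = "addresses t"
  note fin = finite_addresses
  \<comment> \<open>An indicator over a fixed index set replaces the shell, which depends on
    \<open>j\<close>, so that the sums can be exchanged.\<close>
  have restrict: "shell_sum t f r j = (\<Sum>m\<in>?A. if hamming j m = r then f m else 0)" for r j
    unfolding shell_sum_def using sum.inter_filter[OF fin, where g = f] by simp
  have "(\<Sum>p<t. shell_sum t f s (flip_at p i))
      = (\<Sum>m\<in>?A. \<Sum>p<t. if hamming (flip_at p i) m = s then f m else 0)"
    unfolding restrict by (rule sum.swap)
  also have "\<dots> = (\<Sum>m\<in>?A. card {p. p < t \<and> hamming (flip_at p i) m = s} * f m)"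
    by (intro sum.cong refl) (simp add: sum.If_cases Int_def)
  also have "\<dots> = (\<Sum>m\<in>?A. Suc s * (if hamming i m = Suc s then f m else 0)
      + (if s = 0 then 0 else (t - (s - 1)) * (if hamming i m = s - 1 then f m else 0)))"
    by (intro sum.cong refl, unfold card_flips_at_distance[OF i]) (auto simp: algebra_simps)
  also have "\<dots> = Suc s * shell_sum t f (Suc s) i
      + (if s = 0 then 0 else (t - (s - 1)) * shell_sum t f (s - 1) i)"
    unfolding restrict by (simp add: sum.distrib sum_distrib_left)
  finally show ?thesis .
qed

lemma shell_sum_0:
  assumes "i \<in> addresses t"
  shows "shell_sum t f 0 i = f i"
proof -
  have "{j. j \<in> addresses t \<and> hamming i j = 0} = {i}"
    using assms hamming_eq_0_iff by auto
  then show ?thesis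
    by (simp add: shell_sum_def)
qed

section \<open>Correctness\<close>

lemma fst_run_simps:
  "fst (bind_run m f) = fst (f (fst m))"
  "fst (ret x) = x" "fst control = ()"
  "fst (add u v) = u + v" "fst (sub u' v') = u' - v'" "fst (mul u'' v'') = u'' * v''"
  "fst (quot a c) = a / c" "fst (flip p i) = flip_at p i"
  "fst (load C l) = C l" "fst (store l' w C') = C'(l' := w)"
  by (simp_all add: bind_run_def ret_def control_def add_def sub_def mul_def quot_def
      flip_def load_def store_def)

text \<open>The invariant depends on the prefix already processed. Preservation may use the full
  split of \<open>xs\<close>, which lets the loop over rounds recover the round number from the
  prefix length.\<close>

lemma for_each_invariant:
  assumes "P [] s"
    and "\<And>ys x zs s. xs = ys @ x # zs \<Longrightarrow> P ys s \<Longrightarrow> P (ys @ [x]) (fst (f x s))"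
  shows "P xs (fst (for_each xs f s))"
proof -
  have "P (ys @ zs) (fst (for_each zs f s))" if "P ys s" "xs = ys @ zs" for ys zs s
    using that
  proof (induction zs arbitrary: ys s)
    case Nil
    then show ?case by (simp add: fst_run_simps)
  next
    case (Cons z zs)
    from Cons.prems have "P (ys @ [z]) (fst (f z s))"
      by (intro assms(2)) auto
    with Cons.IH[of "ys @ [z]" "fst (f z s)"] Cons.prems(2) show ?case
      by (simp add: fst_run_simps)
  qed
  from this[of "[]" s xs] assms(1) show ?thesis by simp
qed

lemma fst_neighbour_sum:
  "fst (neighbour_sum t k i r C) = (\<Sum>p<t. C (k, flip_at p i, r))"
proof -
  have "fst (neighbour_sum t k i r C) = (\<Sum>p\<leftarrow>[0..<t]. C (k, flip_at p i, r))"
    unfolding neighbour_sum_def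
    by (rule for_each_invariant[where P = "\<lambda>ps s. s = (\<Sum>p\<leftarrow>ps. C (k, flip_at p i, r))"])
      (simp_all add: fst_run_simps)
  then show ?thesis
    by (simp add: sum_list_distinct_conv_sum_set atLeast0LessThan)
qed

text \<open>The bound is strict: \<open>r\<close> is the number of completed rounds.\<close>

definition rounds_correct :: "nat \<Rightarrow> bucket_counts \<Rightarrow> nat \<Rightarrow> nat \<Rightarrow> memory \<Rightarrow> bool" where
  "rounds_correct t b k r C \<longleftrightarrow>
     (\<forall>i\<in>addresses t. \<forall>r'<r. C (k, i, r') = of_nat (shell_sum t (b k) r' i))"

lemma fst_entry:
  assumes C: "rounds_correct t b k r C" and i: "i \<in> addresses t" and r: "r \<le> t"
  shows "fst (entry t b k r i C) = of_nat (shell_sum t (b k) r i)"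
proof -
  have nsum: "fst (neighbour_sum t k i s C) = of_nat (\<Sum>p<t. shell_sum t (b k) s (flip_at p i))"
    if "s < r" for s
    using C that i by (simp add: fst_neighbour_sum rounds_correct_def flip_at_in_addresses)
  consider "r = 0" | "r = 1" | s where "r = Suc (Suc s)"
    by (metis One_nat_def not0_implies_Suc)
  then show ?thesis
  proof cases
    case 1
    then show ?thesis
      using i by (simp add: entry_def fst_run_simps shell_sum_0)
  next
    case 2
    then show ?thesis
      using i nsum[of 0] by (simp add: entry_def fst_run_simps sum_shell_sum_flips)
  next
    case (3 s)
    have prev: "C (k, i, s) = of_nat (shell_sum t (b k) s i)"
      using C i 3 by (simp add: rounds_correct_def)
    \<comment> \<open>Since \<open>s\<close> is at most \<open>r\<close>, hence at most
      \<open>t\<close>, the natural subtraction in the counting identity agrees with the rational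
      one in the program.\<close>
    have coeff: "of_nat (t - s) = (of_nat t - of_nat s :: rat)"
      using r 3 by (simp add: of_nat_diff)
    have "fst (neighbour_sum t k i (Suc s) C)
        = of_nat r * of_nat (shell_sum t (b k) r i)
          + (of_nat t - of_nat s) * of_nat (shell_sum t (b k) s i)"
      using nsum[of "Suc s"] 3 unfolding sum_shell_sum_flips[OF i]
      by (simp add: coeff distrib_right)
    moreover have "(of_nat t - of_nat r + 2 :: rat) = of_nat t - of_nat s"
      using 3 by simp
    moreover have "(of_nat r :: rat) \<noteq> 0"
      using 3 by simp
    moreover have "fst (entry t b k r i C)
        = (fst (neighbour_sum t k i (Suc s) C)
            - (of_nat t - of_nat r + 2) * C (k, i, s)) / of_nat r"
      using 3 by (simp add: entry_def fst_run_simps numeral_2_eq_2)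
    ultimately show ?thesis
      unfolding prev by (metis (lifting) add_diff_cancel_right' nonzero_mult_div_cancel_left)
  qed
qed

text \<open>Updating in place is safe: round \<open>r\<close> writes only cells with index
  \<open>r\<close> and reads only those of earlier rounds. The second claim protects tables finished
  before.\<close>

lemma round_correct:
  fixes C :: memory
  assumes C: "rounds_correct t b k r C" and r: "r \<le> t"
  defines "C' \<equiv> fst (for_each (List.n_lists t [False, True])
    (\<lambda>i C. do { v \<leftarrow> entry t b k r i C; store (k, i, r) v C }) C)"
  shows "rounds_correct t b k (Suc r) C'" and "k' \<noteq> k \<Longrightarrow> C' (k', i', r') = C (k', i', r')"
proof -
  define P :: "address list \<Rightarrow> memory \<Rightarrow> bool" where "P is D \<longleftrightarrow>
      (\<forall>k' i' r'. (k', r') \<noteq> (k, r) \<longrightarrow> D (k', i', r') = C (k', i', r'))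
      \<and> (\<forall>i\<in>set is. D (k, i, r) = of_nat (shell_sum t (b k) r i))" for "is" D
  have "P (List.n_lists t [False, True]) C'"
    unfolding C'_def
  proof (rule for_each_invariant[where P = P])
    show "P [] C"
      by (simp add: P_def)
  next
    fix ys x zs D
    assume eq: "List.n_lists t [False, True] = ys @ x # zs" and D: "P ys D"
    have x: "x \<in> addresses t"
      unfolding addresses_eq_n_lists eq by simp
    \<comment> \<open>The stores made so far in this round have left the cells of all earlier rounds
      as in \<open>C\<close>.\<close>
    have "rounds_correct t b k r D"
      using C D by (auto simp: rounds_correct_def P_def)
    from fst_entry[OF this x r] D
    show "P (ys @ [x]) (fst (do { v \<leftarrow> entry t b k r x D; store (k, x, r) v D }))"
      by (auto simp: P_def fst_run_simps)
  qed
  then have other: "(k', r') \<noteq> (k, r) \<Longrightarrow> C' (k', i', r') = C (k', i', r')"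
    and new: "i' \<in> addresses t \<Longrightarrow> C' (k, i', r) = of_nat (shell_sum t (b k) r i')"
    for k' i' r'
    by (auto simp: P_def addresses_eq_n_lists)
  show "k' \<noteq> k \<Longrightarrow> C' (k', i', r') = C (k', i', r')"
    by (simp add: other)
  show "rounds_correct t b k (Suc r) C'"
    using C other new by (auto simp: rounds_correct_def less_Suc_eq)
qed

lemma aggregate_counts_correct:
  fixes t b k and C :: memory
  defines "C' \<equiv> fst (aggregate_counts t b k C)"
  shows "rounds_correct t b k (Suc t) C'" and "k' \<noteq> k \<Longrightarrow> C' (k', i', r') = C (k', i', r')"
proof -
  define P where "P rs D \<longleftrightarrow> rounds_correct t b k (length rs) D
      \<and> (\<forall>k' i' r'. k' \<noteq> k \<longrightarrow> D (k', i', r') = C (k', i', r'))" for rs :: "nat list" and D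
  have "P [0..<Suc t] C'"
    unfolding C'_def aggregate_counts_def
  proof (rule for_each_invariant[where P = P])
    show "P [] C"
      by (simp add: P_def rounds_correct_def)
  next
    fix ys r zs D
    assume eq: "[0..<Suc t] = ys @ r # zs" and D: "P ys D"
    \<comment> \<open>The rounds are 0, ..., t in order, so the element after the prefix
      \<open>ys\<close> equals its length.\<close>
    have "length ys < Suc t"
      using arg_cong[OF eq, of length] by simp
    moreover from this have "r = length ys"
      using arg_cong[OF eq, of "\<lambda>rs. rs ! length ys"] by (simp del: upt_Suc)
    ultimately have r: "r = length ys" "r \<le> t"
      by simp_all
    from D round_correct[of t b k r D] r
    show "P (ys @ [r]) (fst (for_each (List.n_lists t [False, True])
        (\<lambda>i C. do { v \<leftarrow> entry t b k r i C; store (k, i, r) v C }) D))"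
      by (simp add: P_def)
  qed
  then show "rounds_correct t b k (Suc t) C'"
    and "k' \<noteq> k \<Longrightarrow> C' (k', i', r') = C (k', i', r')"
    by (simp_all add: P_def)
qed

text \<open>A table is correct once processed, whatever the memory held before, and later tables do
  not touch its cells.\<close>

lemma aggregate_all_correct:
  assumes "k < K"
  shows "rounds_correct t b k (Suc t) (fst (aggregate_all K t b C))"
proof -
  define P where "P ks D \<longleftrightarrow> (\<forall>k\<in>set ks. rounds_correct t b k (Suc t) D)" for ks D
  have "P [0..<K] (fst (aggregate_all K t b C))"
    unfolding aggregate_all_def
  proof (rule for_each_invariant[where P = P])
    show "P [] C"
      by (simp add: P_def)
  next
    fix ys k zs D
    assume D: "P ys D"
    have "rounds_correct t b k' (Suc t) (fst (aggregate_counts t b k D))"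
      if "k' \<in> set ys \<or> k' = k" for k'
    proof (cases "k' = k")
      case True
      then show ?thesis
        using aggregate_counts_correct(1) by simp
    next
      case False
      with that D show ?thesis
        by (simp add: P_def rounds_correct_def aggregate_counts_correct(2))
    qed
    then show "P (ys @ [k]) (fst (aggregate_counts t b k D))"
      by (auto simp: P_def)
  qed
  with assms show ?thesis
    by (simp add: P_def)
qed

section \<open>Running time\<close>

lemma arith_ops_simps:
  "arith_ops (bind_run m f) = arith_ops m + arith_ops (f (fst m))"
  "arith_ops (ret x) = 0" "arith_ops control = 0"
  "arith_ops (add u v) = 1" "arith_ops (sub u' v') = 1" "arith_ops (mul u'' v'') = 1"
  "arith_ops (quot a c) = 1" "arith_ops (flip p i) = 0"
  "arith_ops (load C l) = 0" "arith_ops (store l' w C') = 0"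
  by (simp_all add: arith_ops_def bind_run_def ret_def control_def add_def sub_def mul_def
      quot_def flip_def load_def store_def)

lemma total_ops_simps:
  "total_ops (bind_run m f) = total_ops m + total_ops (f (fst m))"
  "total_ops (ret x) = 0" "total_ops control = 1"
  "total_ops (add u v) = 1" "total_ops (sub u' v') = 1" "total_ops (mul u'' v'') = 1"
  "total_ops (quot a c) = 1" "total_ops (flip p i) = 1"
  "total_ops (load C l) = 1" "total_ops (store l' w C') = 1"
  by (simp_all add: total_ops_def bind_run_def ret_def control_def add_def sub_def mul_def
      quot_def flip_def load_def store_def)

lemma arith_ops_for_each_le:
  assumes "\<And>x s. x \<in> set xs \<Longrightarrow> arith_ops (f x s) \<le> B"
  shows "arith_ops (for_each xs f s) \<le> length xs * B"
  using assms
proof (induction xs arbitrary: s)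
  case Nil
  then show ?case by (simp add: arith_ops_simps)
next
  case (Cons x xs)
  have "arith_ops (f x s) \<le> B" "arith_ops (for_each xs f (fst (f x s))) \<le> length xs * B"
    using Cons by simp_all
  then show ?case by (simp add: arith_ops_simps)
qed

text \<open>The successor pays for the \<open>Control\<close> operation of each iteration, which the
  arithmetic count ignores.\<close>

lemma total_ops_for_each_le:
  assumes "\<And>x s. x \<in> set xs \<Longrightarrow> total_ops (f x s) \<le> B"
  shows "total_ops (for_each xs f s) \<le> length xs * Suc B"
  using assms
proof (induction xs arbitrary: s)
  case Nil
  then show ?case by (simp add: total_ops_simps)
next
  case (Cons x xs)
  have "total_ops (f x s) \<le> B" "total_ops (for_each xs f (fst (f x s))) \<le> length xs * Suc B"
    using Cons by simp_all
  then show ?case by (simp add: total_ops_simps)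
qed

lemma arith_ops_neighbour_sum: "arith_ops (neighbour_sum t k i r C) \<le> t"
  unfolding neighbour_sum_def
  by (rule order_trans[OF arith_ops_for_each_le[where B = 1]]) (simp_all add: arith_ops_simps)

lemma total_ops_neighbour_sum: "total_ops (neighbour_sum t k i r C) \<le> 4 * t"
  unfolding neighbour_sum_def
  by (rule order_trans[OF total_ops_for_each_le[where B = 3]]) (simp_all add: total_ops_simps)

text \<open>The bound has no constant term because for \<open>t = 0\<close> the theorem allows no arithmetic
  operation at all.\<close>

lemma arith_ops_entry:
  assumes "r \<le> t"
  shows "arith_ops (entry t b k r i C) \<le> 8 * t"
  \<comment> \<open>For \<open>r\<close> at least 2 there are 7 operations besides the neighbour
    sum, and t + 7 is at most 8 t because t is at least 1.\<close>
  using assms arith_ops_neighbour_sum[of t k i 0 C] arith_ops_neighbour_sum[of t k i "r - 1" C]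
  by (auto simp: entry_def arith_ops_simps fst_run_simps)

text \<open>The 9 covers the case distinction, 7 arithmetic operations and one load outside the
  neighbour sum.\<close>

lemma total_ops_entry: "total_ops (entry t b k r i C) \<le> 4 * t + 9"
  using total_ops_neighbour_sum[of t k i 0 C] total_ops_neighbour_sum[of t k i "r - 1" C]
  by (auto simp: entry_def total_ops_simps fst_run_simps)

lemma arith_ops_aggregate_all:
  "arith_ops (aggregate_all K t b C) \<le> K * (Suc t * (2 ^ t * (8 * t)))"
proof -
  have round: "arith_ops (for_each (List.n_lists t [False, True])
      (\<lambda>i C. do { v \<leftarrow> entry t b k r i C; store (k, i, r) v C }) C) \<le> 2 ^ t * (8 * t)"
    if "r \<le> t" for k r C
    using that
    by (intro order_trans[OF arith_ops_for_each_le[where B = "8 * t"]])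
      (simp_all add: arith_ops_simps arith_ops_entry length_n_lists_Bool)
  have "arith_ops (aggregate_counts t b k C) \<le> Suc t * (2 ^ t * (8 * t))" for k C
    unfolding aggregate_counts_def
    by (rule order_trans[OF arith_ops_for_each_le[where B = "2 ^ t * (8 * t)"]])
      (use round in \<open>auto simp del: upt_Suc\<close>)
  then show ?thesis
    unfolding aggregate_all_def
    by (intro order_trans[OF arith_ops_for_each_le[where B = "Suc t * (2 ^ t * (8 * t))"]])
      simp_all
qed

lemma total_ops_aggregate_all:
  "total_ops (aggregate_all K t b C) \<le> K * Suc (Suc t * Suc (2 ^ t * (4 * t + 11)))"
proof -
  have round: "total_ops (for_each (List.n_lists t [False, True])
      (\<lambda>i C. do { v \<leftarrow> entry t b k r i C; store (k, i, r) v C }) C) \<le> 2 ^ t * (4 * t + 11)"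
    for k r C
  proof -
    have "total_ops (do { v \<leftarrow> entry t b k r i C; store (k, i, r) v C }) \<le> 4 * t + 10" for i C
      using total_ops_entry[of t b k r i C] by (simp add: total_ops_simps)
    then show ?thesis
      by (intro order_trans[OF total_ops_for_each_le[where B = "4 * t + 10"]])
        (simp_all add: length_n_lists_Bool algebra_simps)
  qed
  have "total_ops (aggregate_counts t b k C) \<le> Suc t * Suc (2 ^ t * (4 * t + 11))" for k C
    unfolding aggregate_counts_def
    by (rule order_trans[OF total_ops_for_each_le[where B = "2 ^ t * (4 * t + 11)"]])
      (use round in \<open>auto simp del: upt_Suc\<close>)
  then show ?thesis
    unfolding aggregate_all_def
    by (intro order_trans[OF total_ops_for_each_le[where
            B = "Suc t * Suc (2 ^ t * (4 * t + 11))"]]) simp_all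
qed

lemma arith_ops_aggregate_all_le:
  "arith_ops (aggregate_all K t b C) \<le> 16 * (K * t ^ 2 * 2 ^ t)"
proof -
  \<comment> \<open>For positive \<open>t\<close>, t + 1 is at most 2 t; for \<open>t = 0\<close>
    both sides vanish.\<close>
  have "Suc t * t \<le> 2 * t ^ 2"
    by (cases t) (simp_all add: power2_eq_square)
  then have "8 * K * 2 ^ t * (Suc t * t) \<le> 8 * K * 2 ^ t * (2 * t ^ 2)"
    by (rule mult_le_mono2)
  with arith_ops_aggregate_all[of K t b C] show ?thesis
    by (simp add: algebra_simps)
qed

text \<open>For \<open>t = 0\<close> the right side is 0 although the loops still run when K is
  positive. Otherwise 4 t + 11 is at most 15 t, the inner successor raises 15 to 16, the t + 1
  rounds double this to 32, and the outer successor gives 33.\<close>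

lemma total_ops_aggregate_all_le:
  assumes "t \<ge> 1"
  shows "total_ops (aggregate_all K t b C) \<le> 33 * (K * t ^ 2 * 2 ^ t)"
proof -
  have one: "1 \<le> 2 ^ t * t"
    using assms by simp
  have "Suc (2 ^ t * (4 * t + 11)) \<le> 2 ^ t * t + 2 ^ t * (15 * t)"
    using one assms mult_le_mono2[of "4 * t + 11" "15 * t" "2 ^ t"] by linarith
  also have "\<dots> = 16 * (2 ^ t * t)"
    by simp
  finally have "Suc t * Suc (2 ^ t * (4 * t + 11)) \<le> (2 * t) * (16 * (2 ^ t * t))"
    using assms by (intro mult_le_mono) simp_all
  moreover have "1 \<le> t * (2 ^ t * t)"
    using assms by simp
  ultimately have "Suc (Suc t * Suc (2 ^ t * (4 * t + 11))) \<le> 33 * (t ^ 2 * 2 ^ t)"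
    by (simp add: power2_eq_square algebra_simps)
  then have "K * Suc (Suc t * Suc (2 ^ t * (4 * t + 11))) \<le> K * (33 * (t ^ 2 * 2 ^ t))"
    by (rule mult_le_mono2)
  with total_ops_aggregate_all[of K t b C] show ?thesis
    by (simp add: algebra_simps)
qed

theorem theorem3:
  shows "(\<forall>K t (T :: nat \<Rightarrow> address \<Rightarrow> 'a multiset) C\<^sub>0.
            \<forall>k<K. \<forall>i\<in>addresses t. \<forall>r\<le>t.
              result (aggregate_all K t (\<lambda>k i. size (T k i)) C\<^sub>0) (k, i, r)
              = of_nat (\<Sum>j | j \<in> addresses t \<and> hamming i j = r. size (T k j)))
       \<and> (\<exists>c::real. \<forall>K t b C\<^sub>0.
            real (arith_ops (aggregate_all K t b C\<^sub>0)) \<le> c * (real K * real t ^ 2 * 2 ^ t))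
       \<and> (\<exists>c::real. \<forall>K t b C\<^sub>0. t \<ge> 1 \<longrightarrow>
            real (total_ops (aggregate_all K t b C\<^sub>0)) \<le> c * (real K * real t ^ 2 * 2 ^ t))"
proof (intro conjI allI ballI impI)
  fix K t :: nat and T :: "nat \<Rightarrow> address \<Rightarrow> 'a multiset" and C\<^sub>0 :: memory
    and k r :: nat and i :: address
  assume "k < K" "i \<in> addresses t" "r \<le> t"
  then show "result (aggregate_all K t (\<lambda>k i. size (T k i)) C\<^sub>0) (k, i, r)
      = of_nat (\<Sum>j | j \<in> addresses t \<and> hamming i j = r. size (T k j))"
    using aggregate_all_correct[of k K t "\<lambda>k i. size (T k i)" C\<^sub>0]
    by (simp add: rounds_correct_def result_def shell_sum_def)
next
  have "real (arith_ops (aggregate_all K t b C\<^sub>0)) \<le> 16 * (real K * real t ^ 2 * 2 ^ t)"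
    for K t b C\<^sub>0
    using of_nat_mono[OF arith_ops_aggregate_all_le[of K t b C\<^sub>0], where 'a = real] by simp
  then show "\<exists>c::real. \<forall>K t b C\<^sub>0.
      real (arith_ops (aggregate_all K t b C\<^sub>0)) \<le> c * (real K * real t ^ 2 * 2 ^ t)"
    by blast
next
  have "real (total_ops (aggregate_all K t b C\<^sub>0)) \<le> 33 * (real K * real t ^ 2 * 2 ^ t)"
    if "t \<ge> 1" for K t b C\<^sub>0
    using of_nat_mono[OF total_ops_aggregate_all_le[OF that, of K b C\<^sub>0], where 'a = real] by simp
  then show "\<exists>c::real. \<forall>K t b C\<^sub>0. t \<ge> 1 \<longrightarrow>
      real (total_ops (aggregate_all K t b C\<^sub>0)) \<le> c * (real K * real t ^ 2 * 2 ^ t)"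
    by blast
qed

end
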